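(* Let $V$ be a finite set with positive integer weights $\vec{w}(v)$, $v \in V$, and let $\mathcal{W}$ be a finite (multi)collection of subsets of $V$ such that every $v \in V$ belongs to exactly $\vec{w}(v)$ members of $\mathcal{W}$; write $\mathcal{W}(v)$ for the members of $\mathcal{W}$ containing $v$, $\gamma_v = 1/\vec{w}(v)$, and $\gamma_W = \sum_{v \in W}\gamma_v$. For a pseudo-distribution $\vec{p}$ on $V$ let $\vec{q}(W) = \sum_{v \in W}\gamma_v \vec{p}(v)$ for $W\in\mathcal{W}$ and $\vec{p}'(v) = \sum_{W \in \mathcal{W}(v)}\frac{\gamma_v}{\gamma_W}\vec{q}(W)$ for $v \in V$. Then for every pseudo-distribution $\vec{p}$ on $V$, $H(\vec{p}') \geq H(\vec{p})$; that is, every two-step mixing process has stable entropy.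
   Context: All logarithms are natural logarithms. A pseudo-distribution on a finite set $S$ is a vector $\vec{p}\in[0,1]^S$; its entropy is $H(\vec{p}) = \sum_{i} H(\vec{p}(i))$ with $H(u) = -u \log u$ for $u>0$ and $H(0)=0$ (the same formula is used for the nonnegative vector $\vec{p}'$). The map $\vec{p}\mapsto\vec{p}'$ is called a two-step mixing process; a random walk has stable entropy if one step never decreases the entropy of any state distribution. *)

theory Defs
  imports Complex_Main "HOL-Library.Multiset"
begin

definition ent :: "real \<Rightarrow> real" where
  "ent u = (if u > 0 then - u * ln u else 0)"

text \<open>Vectors indexed by a finite set \<open>S\<close> are functions of which only the values on \<open>S\<close> matter.\<close>

definition entropy :: "'a set \<Rightarrow> ('a \<Rightarrow> real) \<Rightarrow> real" where
  "entropy S p = (\<Sum>i\<in>S. ent (p i))"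

definition pseudo_distribution :: "'a set \<Rightarrow> ('a \<Rightarrow> real) \<Rightarrow> bool" where
  "pseudo_distribution S p \<longleftrightarrow> (\<forall>i\<in>S. 0 \<le> p i \<and> p i \<le> 1)"

definition state_distribution :: "'a set \<Rightarrow> ('a \<Rightarrow> real) \<Rightarrow> bool" where
  "state_distribution S p \<longleftrightarrow> (\<forall>i\<in>S. 0 \<le> p i) \<and> (\<Sum>i\<in>S. p i) = 1"

text \<open>A random walk on \<open>S\<close> enters only through its one-step map \<open>T\<close> on state distributions.\<close>

definition stable_entropy :: "'a set \<Rightarrow> (('a \<Rightarrow> real) \<Rightarrow> ('a \<Rightarrow> real)) \<Rightarrow> bool" where
  "stable_entropy S T \<longleftrightarrow> (\<forall>p. state_distribution S p \<longrightarrow> entropy S (T p) \<ge> entropy S p)"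

text \<open>The members of \<open>\<W>\<close> containing a vertex are counted with multiplicity, as is every sum over
  \<open>\<W>\<close> below. The empty set is allowed as a member.\<close>

abbreviation members_at :: "'a set multiset \<Rightarrow> 'a \<Rightarrow> 'a set multiset" where
  "members_at \<W> v \<equiv> {#W \<in># \<W>. v \<in> W#}"

definition weighted_cover :: "'a set \<Rightarrow> ('a \<Rightarrow> nat) \<Rightarrow> 'a set multiset \<Rightarrow> bool" where
  "weighted_cover V w \<W> \<longleftrightarrow>
     finite V \<and> (\<forall>v\<in>V. 0 < w v) \<and> (\<forall>W\<in>#\<W>. W \<subseteq> V) \<and>
     (\<forall>v\<in>V. size (members_at \<W> v) = w v)"

definition gamma :: "('a \<Rightarrow> nat) \<Rightarrow> 'a \<Rightarrow> real" where
  "gamma w v = 1 / real (w v)"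

definition gamma_set :: "('a \<Rightarrow> nat) \<Rightarrow> 'a set \<Rightarrow> real" where
  "gamma_set w W = (\<Sum>v\<in>W. gamma w v)"

definition mix_half :: "('a \<Rightarrow> nat) \<Rightarrow> ('a \<Rightarrow> real) \<Rightarrow> 'a set \<Rightarrow> real" where
  "mix_half w p W = (\<Sum>v\<in>W. gamma w v * p v)"

definition two_step_mixing :: "('a \<Rightarrow> nat) \<Rightarrow> 'a set multiset \<Rightarrow> ('a \<Rightarrow> real) \<Rightarrow> 'a \<Rightarrow> real" where
  "two_step_mixing w \<W> p v =
     (\<Sum>W\<in>#members_at \<W> v. gamma w v / gamma_set w W * mix_half w p W)"

end

theory Submission
  imports Defs
begin

text \<open>One round of the process is multiplication by the matrix
  \<open>M v u = (\<Sum>W \<ni> v, u. \<gamma>\<^sub>v \<gamma>\<^sub>u / \<gamma>\<^sub>W)\<close>. It is symmetric, and its rows sum to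
  \<open>\<gamma>\<^sub>v w(v) = 1\<close>, so it is doubly stochastic. A doubly stochastic matrix cannot decrease the
  entropy, because \<open>ent\<close> lies below its tangents.\<close>

text \<open>The right-hand side is the tangent to \<open>ent\<close> at \<open>b\<close>, evaluated
  at \<open>a\<close>. For positive \<open>a\<close> the bound is \<open>ln x \<le> x - 1\<close> at
  \<open>x = b / a\<close>, multiplied by \<open>a\<close>.\<close>

lemma ent_le_tangent:
  assumes "0 \<le> a" "0 < b"
  shows "ent a \<le> b - a - a * ln b"
proof (cases "a = 0")
  case False
  then have a: "0 < a" using assms by simp
  have "ln (b / a) \<le> b / a - 1"
    using a assms by (intro ln_le_minus_one) simp
  then have "a * ln (b / a) \<le> a * (b / a - 1)"
    using a by (intro mult_left_mono) auto
  then show ?thesis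
    using a assms by (simp add: ent_def ln_div algebra_simps)
qed (use assms in \<open>simp add: ent_def\<close>)

text \<open>Jensen's inequality for \<open>ent\<close>: average over \<open>c\<close> the tangent
  inequality taken at the mean \<open>b\<close>. Since the weights sum to 1, the terms linear in
  \<open>p u - b\<close> cancel and \<open>ent b\<close> remains.\<close>

lemma weighted_mean_ent_le:
  assumes "finite S" "\<And>u. u \<in> S \<Longrightarrow> 0 \<le> c u" "sum c S = 1" "\<And>u. u \<in> S \<Longrightarrow> 0 \<le> p u"
  shows "(\<Sum>u\<in>S. c u * ent (p u)) \<le> ent (\<Sum>u\<in>S. c u * p u)"
proof -
  define b where "b = (\<Sum>u\<in>S. c u * p u)"
  have "0 \<le> b" unfolding b_def using assms by (intro sum_nonneg) simp
  show ?thesis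
  proof (cases "b = 0")
    \<comment> \<open>There is no tangent at 0, where the slope is infinite. But a zero mean forces
      \<open>c u = 0\<close> or \<open>p u = 0\<close> for each \<open>u\<close>, so the left-hand
      side vanishes as well.\<close>
    case True
    then have "\<forall>u\<in>S. c u * p u = 0"
      unfolding b_def using assms by (subst (asm) sum_nonneg_eq_0_iff) auto
    then have "(\<Sum>u\<in>S. c u * ent (p u)) = 0"
      by (intro sum.neutral) (auto simp: ent_def)
    with True show ?thesis by (simp add: b_def ent_def)
  next
    case False
    with \<open>0 \<le> b\<close> have "0 < b" by simp
    have "(\<Sum>u\<in>S. c u * ent (p u)) \<le> (\<Sum>u\<in>S. c u * (b - p u - p u * ln b))"
      using assms \<open>0 < b\<close> by (intro sum_mono mult_left_mono ent_le_tangent) auto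
    also have "\<dots> = (\<Sum>u\<in>S. c u * b - c u * p u - c u * p u * ln b)"
      by (simp add: algebra_simps)
    also have "\<dots> = sum c S * b - b - b * ln b"
      by (simp add: sum_subtractf b_def sum_distrib_right)
    also have "\<dots> = ent b" using assms(3) \<open>0 < b\<close> by (simp add: ent_def)
    finally show ?thesis by (simp add: b_def)
  qed
qed

text \<open>The column sums distribute each \<open>ent (p u)\<close> over the rows; the row sums
  make each row a weighted mean, to which Jensen's inequality applies.\<close>

lemma entropy_doubly_stochastic:
  assumes "finite S"
    and nonneg: "\<And>v u. v \<in> S \<Longrightarrow> u \<in> S \<Longrightarrow> 0 \<le> M v u"
    and row: "\<And>v. v \<in> S \<Longrightarrow> (\<Sum>u\<in>S. M v u) = 1"
    and col: "\<And>u. u \<in> S \<Longrightarrow> (\<Sum>v\<in>S. M v u) = 1"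
    and p: "\<And>u. u \<in> S \<Longrightarrow> 0 \<le> p u"
  shows "entropy S p \<le> entropy S (\<lambda>v. \<Sum>u\<in>S. M v u * p u)"
proof -
  have "entropy S p = (\<Sum>u\<in>S. (\<Sum>v\<in>S. M v u) * ent (p u))"
    using col by (simp add: entropy_def)
  also have "\<dots> = (\<Sum>v\<in>S. \<Sum>u\<in>S. M v u * ent (p u))"
    by (subst sum.swap) (simp add: sum_distrib_right)
  also have "\<dots> \<le> entropy S (\<lambda>v. \<Sum>u\<in>S. M v u * p u)"
    unfolding entropy_def using assms by (intro sum_mono weighted_mean_ent_le) auto
  finally show ?thesis .
qed

lemma sum_sum_mset_swap:
  "(\<Sum>u\<in>S. \<Sum>W\<in>#A. f u W) = (\<Sum>W\<in>#A. \<Sum>u\<in>S. f u W :: 'b :: comm_monoid_add)"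
  by (induction A) (auto simp: sum.distrib)

lemma sum_mset_filter_mset:
  "(\<Sum>x\<in>#filter_mset P A. f x) = (\<Sum>x\<in>#A. if P x then f x else 0 :: 'b :: comm_monoid_add)"
  by (induction A) auto

text \<open>The membership conditions sit in the summand, so that all entries are sums over the same
  multiset. This keeps the symmetry visible and allows exchanging sums over \<open>\<W>\<close> and
  \<open>V\<close>.\<close>

definition mixing_matrix :: "('a \<Rightarrow> nat) \<Rightarrow> 'a set multiset \<Rightarrow> 'a \<Rightarrow> 'a \<Rightarrow> real" where
  "mixing_matrix w \<W> v u =
     (\<Sum>W\<in>#\<W>. if v \<in> W \<and> u \<in> W then gamma w v * gamma w u / gamma_set w W else 0)"

lemma mixing_matrix_commute: "mixing_matrix w \<W> v u = mixing_matrix w \<W> u v"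
  unfolding mixing_matrix_def by (simp only: mult.commute[of "gamma w v"] conj_commute[of "v \<in> _"])

lemma mixing_matrix_nonneg: "0 \<le> mixing_matrix w \<W> v u"
proof -
  have "0 \<le> gamma_set w W" for W
    unfolding gamma_set_def by (intro sum_nonneg) (simp add: gamma_def)
  then show ?thesis
    unfolding mixing_matrix_def by (induction \<W>) (auto simp: gamma_def)
qed

lemma two_step_mixing_eq:
  assumes "weighted_cover V w \<W>"
  shows "two_step_mixing w \<W> p v = (\<Sum>u\<in>V. mixing_matrix w \<W> v u * p u)"
proof -
  have fin: "finite V" and sub: "\<And>W. W \<in># \<W> \<Longrightarrow> W \<subseteq> V"
    using assms by (auto simp: weighted_cover_def)
  have "(\<Sum>u\<in>V. mixing_matrix w \<W> v u * p u) =
      (\<Sum>W\<in>#\<W>. \<Sum>u\<in>V. (if v \<in> W \<and> u \<in> W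
          then gamma w v * gamma w u / gamma_set w W else 0) * p u)"
    by (simp add: mixing_matrix_def sum_mset_distrib_right sum_sum_mset_swap)
  also have "\<dots> = (\<Sum>W\<in>#\<W>. if v \<in> W then gamma w v / gamma_set w W * mix_half w p W else 0)"
  proof (intro arg_cong[where f = sum_mset] image_mset_cong)
    fix W assume "W \<in># \<W>"
    then have "V \<inter> W = W" using sub by blast
    have "(\<Sum>u\<in>V. (if v \<in> W \<and> u \<in> W then gamma w v * gamma w u / gamma_set w W else 0) * p u) =
        (\<Sum>u\<in>V. if u \<in> W then
           (if v \<in> W then gamma w v / gamma_set w W * (gamma w u * p u) else 0) else 0)"
      by (intro sum.cong) auto
    also have "\<dots> = (\<Sum>u\<in>W. if v \<in> W then gamma w v / gamma_set w W * (gamma w u * p u) else 0)"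
      \<comment> \<open>The indicator of \<open>W\<close> restricts the sum from \<open>V\<close> to
        \<open>V \<inter> W\<close>, which is \<open>W\<close>.\<close>
      using fin \<open>V \<inter> W = W\<close> by (simp flip: sum.inter_restrict)
    also have "\<dots> = (if v \<in> W then gamma w v / gamma_set w W * mix_half w p W else 0)"
      by (simp add: mix_half_def sum_distrib_left)
    finally show "(\<Sum>u\<in>V. (if v \<in> W \<and> u \<in> W
          then gamma w v * gamma w u / gamma_set w W else 0) * p u) = \<dots>" .
  qed
  finally show ?thesis
    unfolding two_step_mixing_def sum_mset_filter_mset ..
qed

text \<open>This computes the row sums of the matrix. On the constant 1, \<open>mix_half\<close>
  equals \<open>gamma_set\<close>, so each of the \<open>w v\<close> members at \<open>v\<close>
  contributes exactly \<open>gamma w v\<close>.\<close>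

lemma two_step_mixing_one:
  assumes "weighted_cover V w \<W>" "v \<in> V"
  shows "two_step_mixing w \<W> (\<lambda>_. 1) v = 1"
proof -
  have w: "\<And>u. u \<in> V \<Longrightarrow> 0 < w u" and sz: "size (members_at \<W> v) = w v"
    using assms by (auto simp: weighted_cover_def)
  \<comment> \<open>A member at \<open>v\<close> is nonempty, so its \<open>gamma_set\<close> is a
    nonempty sum of positive terms and may be cancelled.\<close>
  have "gamma_set w W \<noteq> 0" if "W \<in># members_at \<W> v" for W
  proof -
    have "W \<subseteq> V" "v \<in> W" "finite W"
      using that assms by (auto simp: weighted_cover_def intro: finite_subset)
    then have "0 < gamma_set w W"
      unfolding gamma_set_def using w by (intro sum_pos) (auto simp: gamma_def)
    then show ?thesis by simp
  qed
  then have "two_step_mixing w \<W> (\<lambda>_. 1) v = (\<Sum>W\<in>#members_at \<W> v. gamma w v)"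
    unfolding two_step_mixing_def
    by (intro arg_cong[where f = sum_mset] image_mset_cong)
      (simp add: mix_half_def flip: gamma_set_def)
  also have "\<dots> = 1"
    using w[OF assms(2)] by (simp add: sum_mset_constant sz gamma_def)
  finally show ?thesis .
qed

text \<open>Stated for nonnegative vectors, this covers pseudo-distributions and state distributions
  at once.\<close>

lemma entropy_two_step_mixing:
  assumes "weighted_cover V w \<W>" "\<And>v. v \<in> V \<Longrightarrow> 0 \<le> p v"
  shows "entropy V p \<le> entropy V (two_step_mixing w \<W> p)"
proof -
  have row: "(\<Sum>u\<in>V. mixing_matrix w \<W> v u) = 1" if "v \<in> V" for v
    using two_step_mixing_one[OF assms(1) that] by (simp add: two_step_mixing_eq[OF assms(1)])
  have "entropy V p \<le> entropy V (\<lambda>v. \<Sum>u\<in>V. mixing_matrix w \<W> v u * p u)"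
  proof (intro entropy_doubly_stochastic row mixing_matrix_nonneg assms(2))
    show "finite V" using assms(1) by (simp add: weighted_cover_def)
    \<comment> \<open>By symmetry a column sum is a row sum.\<close>
    show "(\<Sum>v\<in>V. mixing_matrix w \<W> v u) = 1" if "u \<in> V" for u
      using row[OF that] by (simp add: mixing_matrix_commute[of w \<W> _ u])
  qed
  then show ?thesis by (simp add: two_step_mixing_eq[OF assms(1), abs_def])
qed

theorem theorem3p9:
  fixes V :: "'a set" and w :: "'a \<Rightarrow> nat" and \<W> :: "'a set multiset"
  assumes "weighted_cover V w \<W>"
  shows "(\<forall>p. pseudo_distribution V p \<longrightarrow>
              entropy V (two_step_mixing w \<W> p) \<ge> entropy V p) \<and>
         stable_entropy V (two_step_mixing w \<W>)"
  using entropy_two_step_mixing[OF assms]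
  by (auto simp: stable_entropy_def pseudo_distribution_def state_distribution_def)

end
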